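(* Let $(f_n)_{n\ge 0}$ be the sequence defined by $f_0=9$ and $f_n-f_{n-1}=7\cdot 2^{2n}$ for all $n\ge 1$. Then $f_n=\frac{1}{3}\left[7\cdot 2^{2n+2}-1\right]$ for all $n\ge 0$; for every odd number in the set $\{f_n : n\ge 0\}$, repeated application of the Collatz function $f$ eventually reaches $1$; and for each $n\ge 0$ the number of Collatz function operations needed to get $1$ from $f_n$ is $N_{f_n}=N_{7}+2n+3$.
   Context: The Collatz function $f:\mathbb{Z}_{\ge 1}\to\mathbb{Z}_{\ge 1}$ (not to be confused with the sequence terms $f_n$) is defined by $f(n)=n/2$ if $n$ is even and $f(n)=3n+1$ if $n$ is odd. For a positive integer $k$, $N_k$ denotes the number of Collatz function operations for the number $k$ to get $1$, i.e. the least integer $m\ge 1$ such that the $m$-fold iterate satisfies $f^{m}(k)=1$ (so that $N_1=3$, via $1\to 4\to 2\to 1$), with $N_k=\infty$ if there is no such $m$. *)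

theory Defs
  imports Complex_Main "HOL-Library.Extended_Nat"
begin

(* The intended domain is the positive integers, which collatz maps to themselves;
   the value collatz 0 = 0 is irrelevant. *)
definition collatz :: "nat \<Rightarrow> nat" where
  "collatz n = (if even n then n div 2 else 3 * n + 1)"

(* The exponent is required to be positive, so the value at 1 is 3 (1, 4, 2, 1), not 0. *)
definition collatz_count :: "nat \<Rightarrow> enat" where
  "collatz_count k =
     (if \<exists>m\<ge>1. (collatz ^^ m) k = 1
      then enat (LEAST m. m \<ge> 1 \<and> (collatz ^^ m) k = 1)
      else \<infinity>)"

end

theory Submission
  imports Defs
begin

text \<open>
  The recurrence sums to the closed form \<open>3 * f n + 1 = 7 * 2 ^ (2 * n + 2)\<close>. This makes every
  \<open>f n\<close> odd, and its Collatz orbit is then forced: one step \<open>x \<mapsto> 3 * x + 1\<close> lands on \<open>7\<close> times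
  a power of two, and \<open>2 * n + 2\<close> halvings remove that power and arrive at \<open>7\<close>. All values met
  on the way are at least \<open>7\<close>, hence \<open>1\<close> is not met earlier, so the stopping time of \<open>f n\<close>
  is that of \<open>7\<close> plus the \<open>2 * n + 3\<close> steps made. Since \<open>7\<close> itself reaches \<open>1\<close>, so does each
  \<open>f n\<close>.

  The additivity of stopping times is reduced to a single step (\<open>collatz_count_step\<close>) and iterated
  along the halvings (\<open>collatz_count_power_of_two_mult\<close>).
\<close>

text \<open>
  The least positive exponent drops by one along a step that does not itself land on \<open>1\<close>.
  The hypothesis cannot be omitted: for \<open>x = 2\<close> the left side is \<open>1\<close>, whereas the right side
  is \<open>4\<close>, because only positive exponents count.
\<close>
lemma collatz_count_step:
  assumes "collatz x \<noteq> 1"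
  shows "collatz_count x = collatz_count (collatz x) + 1"
proof -
  define P where "P = (\<lambda>m. m \<ge> 1 \<and> (collatz ^^ m) x = 1)"
  define Q where "Q = (\<lambda>m. m \<ge> 1 \<and> (collatz ^^ m) (collatz x) = 1)"
  have shift: "P (Suc m) \<longleftrightarrow> Q m" for m
    using assms by (cases m) (auto simp: P_def Q_def funpow_swap1)
  have "\<not> P 0"
    by (simp add: P_def)
  hence ex: "(\<exists>m. P m) \<longleftrightarrow> (\<exists>m. Q m)"
    using shift by (metis not0_implies_Suc)
  have least: "(LEAST m. P m) = Suc (LEAST m. Q m)" if "\<exists>m. P m"
    using that Least_Suc[of P _, OF _ \<open>\<not> P 0\<close>] by (auto simp: shift)
  have "collatz_count x = (if \<exists>m. P m then enat (LEAST m. P m) else \<infinity>)"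
    "collatz_count (collatz x) = (if \<exists>m. Q m then enat (LEAST m. Q m) else \<infinity>)"
    by (simp_all add: collatz_count_def P_def Q_def)
  thus ?thesis
    using ex least by (auto simp: one_enat_def)
qed

lemma collatz_count_power_of_two_mult:
  assumes "m > 1"
  shows "collatz_count (m * 2 ^ k) = collatz_count m + enat k"
proof (induction k)
  case 0
  show ?case by (simp flip: zero_enat_def)
next
  case (Suc k)
  have halve: "collatz (m * 2 ^ Suc k) = m * 2 ^ k"
    by (simp add: collatz_def)
  have "m * 2 ^ k \<noteq> 1"
    using assms by simp
  hence "collatz_count (m * 2 ^ Suc k) = collatz_count (m * 2 ^ k) + 1"
    using collatz_count_step[of "m * 2 ^ Suc k"] halve by simp
  thus ?case
    by (simp add: Suc.IH one_enat_def add.assoc)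
qed

lemma collatz_count_finite_iff:
  "collatz_count x \<noteq> \<infinity> \<longleftrightarrow> (\<exists>m\<ge>1. (collatz ^^ m) x = 1)"
  by (simp add: collatz_count_def)

text \<open>
  The orbit is
  \<open>7, 22, 11, 34, 17, 52, 26, 13, 40, 20, 10, 5, 16, 8, 4, 2, 1\<close>.
\<close>
lemma collatz_count_7_finite: "collatz_count 7 \<noteq> \<infinity>"
proof -
  have even_step: "collatz (numeral (num.Bit0 k)) = numeral k" for k
    by (simp add: collatz_def)
  have odd_step: "collatz (numeral (num.Bit1 k)) = 3 * numeral (num.Bit1 k) + 1" for k
    by (simp add: collatz_def)
  have unroll: "(collatz ^^ numeral k) x = (collatz ^^ pred_numeral k) (collatz x)" for k x
    by (simp add: numeral_eq_Suc funpow_swap1)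
  have "(collatz ^^ 16) 7 = 1"
    by (simp add: unroll even_step odd_step)
  thus ?thesis
    unfolding collatz_count_finite_iff by (intro exI[of _ 16]) simp
qed

theorem theorem6:
  fixes f :: "nat \<Rightarrow> nat"
  assumes "f 0 = 9"
    and "\<And>n. n \<ge> 1 \<Longrightarrow> int (f n) - int (f (n - 1)) = 7 * 2 ^ (2 * n)"
  shows "(\<forall>n. real (f n) = 1 / 3 * (7 * 2 ^ (2 * n + 2) - 1)) \<and>
         (\<forall>x \<in> {f n | n. n \<ge> 0}. odd x \<longrightarrow> (\<exists>m. (collatz ^^ m) x = 1)) \<and>
         (\<forall>n. collatz_count (f n) = collatz_count 7 + enat (2 * n + 3))"
proof -
  have closed: "3 * f n + 1 = 7 * 2 ^ (2 * n + 2)" for n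
  proof (induction n)
    case 0
    show ?case using assms(1) by simp
  next
    case (Suc n)
    have "int (f (Suc n)) = int (f n) + 7 * 2 ^ (2 * Suc n)"
      using assms(2)[of "Suc n"] by simp
    hence "int (3 * f (Suc n) + 1) = int (3 * f n + 1) + 21 * 2 ^ (2 * Suc n)"
      by simp
    also have "\<dots> = int (7 * 2 ^ (2 * Suc n + 2))"
      unfolding Suc.IH by simp
    finally show ?case
      using of_nat_eq_iff by blast
  qed
  have real_form: "real (f n) = 1 / 3 * (7 * 2 ^ (2 * n + 2) - 1)" for n
  proof -
    have "real (3 * f n + 1) = 7 * 2 ^ (2 * n + 2)"
      unfolding closed by simp
    thus ?thesis by simp
  qed
  have count: "collatz_count (f n) = collatz_count 7 + enat (2 * n + 3)" for n
  proof -
    have "even (3 * f n + 1)"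
      unfolding closed by simp
    hence "collatz (f n) = 7 * 2 ^ (2 * n + 2)"
      using closed[of n] by (simp add: collatz_def)
    moreover have "7 * 2 ^ (2 * n + 2) \<noteq> (1 :: nat)"
      by simp
    ultimately have "collatz_count (f n) = collatz_count (7 * 2 ^ (2 * n + 2)) + 1"
      using collatz_count_step[of "f n"] by simp
    also have "\<dots> = collatz_count 7 + enat (2 * n + 2) + 1"
      by (subst collatz_count_power_of_two_mult) simp_all
    also have "\<dots> = collatz_count 7 + enat (2 * n + 3)"
      by (simp add: one_enat_def add.assoc)
    finally show ?thesis .
  qed
  have "\<exists>m. (collatz ^^ m) (f n) = 1" for n
  proof -
    have "collatz_count (f n) \<noteq> \<infinity>"
      using count[of n] collatz_count_7_finite by auto
    thus ?thesis
      unfolding collatz_count_finite_iff by blast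
  qed
  with real_form count show ?thesis
    by blast
qed

end
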